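(* Let $G$ be a locally compact group, $a\in\mathcal R(G)$ and $f\in L^\infty(G)$ such that $M(f)a$ is a non-zero finite rank operator on $L^2(G)$. Then $G$ has a compact open subgroup.
   Context: $R$ is the right regular representation $R_x\xi(y)=\Delta_G(x)^{1/2}\xi(yx)$ on $L^2(G)$ ($\Delta_G$ the modular function), $\mathcal R(G)=\{R_x\mid x\in G\}''$, and $M(f)$ is the operator of multiplication by $f$ on $L^2(G)$. *)

theory Defs
  imports "HOL-Analysis.Analysis"
begin

text \<open>A locally compact (Hausdorff) group is modelled as a type of class
  topological_group_add + t2_space (group written additively but NOT assumed
  commutative) whose topology is locally compact.\<close>

definition lc_group :: "'g::{topological_group_add,t2_space} itself \<Rightarrow> bool" where
  "lc_group _ \<longleftrightarrow> locally_compact_space (euclidean :: 'g topology)"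

definition haar_measure :: "'g::{topological_group_add,t2_space} measure \<Rightarrow> bool" where
  "haar_measure \<mu> \<longleftrightarrow>
     sets \<mu> = sets borel \<and>
     (\<forall>x. \<forall>A\<in>sets borel. emeasure \<mu> ((\<lambda>y. x + y) ` A) = emeasure \<mu> A) \<and>
     (\<forall>K. compact K \<longrightarrow> emeasure \<mu> K < \<infinity>) \<and>
     (\<forall>U. open U \<and> U \<noteq> {} \<longrightarrow> emeasure \<mu> U > 0) \<and>
     (\<forall>A\<in>sets borel. emeasure \<mu> A = (INF U\<in>{U. open U \<and> A \<subseteq> U}. emeasure \<mu> U)) \<and>
     (\<forall>U. open U \<longrightarrow> emeasure \<mu> U = (SUP K\<in>{K. compact K \<and> K \<subseteq> U}. emeasure \<mu> K))"

definition modular :: "'g::{topological_group_add,t2_space} measure \<Rightarrow> 'g \<Rightarrow> real" where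
  "modular \<mu> x = (SOME d. d > 0 \<and>
      (\<forall>A\<in>sets borel. emeasure \<mu> ((\<lambda>y. y + x) ` A) = ennreal d * emeasure \<mu> A))"

text \<open>L^2(G) as a set of representatives; operators act on representatives and
  are identified modulo almost-everywhere equality.\<close>
definition L2 :: "'a measure \<Rightarrow> ('a \<Rightarrow> complex) set" where
  "L2 \<mu> = {\<xi>. \<xi> \<in> borel_measurable \<mu> \<and> integrable \<mu> (\<lambda>x. (norm (\<xi> x))^2)}"

definition L2norm :: "'a measure \<Rightarrow> ('a \<Rightarrow> complex) \<Rightarrow> real" where
  "L2norm \<mu> \<xi> = sqrt (integral\<^sup>L \<mu> (\<lambda>x. (norm (\<xi> x))^2))"

type_synonym 'a op = "('a \<Rightarrow> complex) \<Rightarrow> ('a \<Rightarrow> complex)"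

definition bounded_op :: "'a measure \<Rightarrow> 'a op \<Rightarrow> bool" where
  "bounded_op \<mu> T \<longleftrightarrow>
     (\<forall>\<xi>\<in>L2 \<mu>. T \<xi> \<in> L2 \<mu>) \<and>
     (\<forall>\<xi>\<in>L2 \<mu>. \<forall>\<eta>\<in>L2 \<mu>. (AE x in \<mu>. \<xi> x = \<eta> x) \<longrightarrow> (AE x in \<mu>. T \<xi> x = T \<eta> x)) \<and>
     (\<forall>\<xi>\<in>L2 \<mu>. \<forall>\<eta>\<in>L2 \<mu>. \<forall>c. AE x in \<mu>. T (\<lambda>y. c * \<xi> y + \<eta> y) x = c * T \<xi> x + T \<eta> x) \<and>
     (\<exists>C. \<forall>\<xi>\<in>L2 \<mu>. L2norm \<mu> (T \<xi>) \<le> C * L2norm \<mu> \<xi>)"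

definition op_eq :: "'a measure \<Rightarrow> 'a op \<Rightarrow> 'a op \<Rightarrow> bool" where
  "op_eq \<mu> S T \<longleftrightarrow> (\<forall>\<xi>\<in>L2 \<mu>. AE x in \<mu>. S \<xi> x = T \<xi> x)"

definition commutant :: "'a measure \<Rightarrow> 'a op set \<Rightarrow> 'a op set" where
  "commutant \<mu> S = {T. bounded_op \<mu> T \<and> (\<forall>A\<in>S. op_eq \<mu> (T \<circ> A) (A \<circ> T))}"

definition right_reg :: "'g::{topological_group_add,t2_space} measure \<Rightarrow> 'g \<Rightarrow> 'g op" where
  "right_reg \<mu> x = (\<lambda>\<xi> y. complex_of_real (sqrt (modular \<mu> x)) * \<xi> (y + x))"

definition right_vN :: "'g::{topological_group_add,t2_space} measure \<Rightarrow> 'g op set" where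
  "right_vN \<mu> = commutant \<mu> (commutant \<mu> (range (right_reg \<mu>)))"

definition Linf :: "'g::{topological_group_add,t2_space} measure \<Rightarrow> ('g \<Rightarrow> complex) set" where
  "Linf \<mu> = {f. f \<in> borel_measurable borel \<and>
      (\<exists>C. \<forall>K. compact K \<longrightarrow> (AE x in \<mu>. x \<in> K \<longrightarrow> norm (f x) \<le> C))}"

definition mult_op :: "('a \<Rightarrow> complex) \<Rightarrow> 'a op" where
  "mult_op f = (\<lambda>\<xi> y. f y * \<xi> y)"

definition finite_rank_op :: "'a measure \<Rightarrow> 'a op \<Rightarrow> bool" where
  "finite_rank_op \<mu> T \<longleftrightarrow> (\<exists>B. finite B \<and> B \<subseteq> L2 \<mu> \<and>
      (\<forall>\<xi>\<in>L2 \<mu>. \<exists>c. AE y in \<mu>. T \<xi> y = (\<Sum>b\<in>B. c b * b y)))"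

definition nonzero_op :: "'a measure \<Rightarrow> 'a op \<Rightarrow> bool" where
  "nonzero_op \<mu> T \<longleftrightarrow> (\<exists>\<xi>\<in>L2 \<mu>. \<not> (AE y in \<mu>. T \<xi> y = 0))"

definition group_subgroup :: "'g::group_add set \<Rightarrow> bool" where
  "group_subgroup H \<longleftrightarrow> 0 \<in> H \<and> (\<forall>x\<in>H. \<forall>y\<in>H. x + y \<in> H) \<and> (\<forall>x\<in>H. - x \<in> H)"

end

theory Submission
  imports Defs
begin

text \<open>Left translations commute with the right regular representation, so \<open>a\<close> commutes with them and
  its range \<open>A\<close> is a left translation invariant subspace of \<open>L\<^sup>2(G)\<close>. Finite rank of \<open>M(f)a\<close> makes
  the restriction of \<open>A\<close> to a compact set of positive measure on which \<open>f\<close> and some \<open>u \<in> A\<close> have no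
  zeros finite-dimensional and non-zero. Choose a compact subset \<open>C\<close> of positive measure where this
  dimension is minimal. For \<open>x\<close> near the identity, \<open>C \<inter> xC\<close> has positive measure, so by
  minimality an element of \<open>A\<close> vanishing on one of \<open>C\<close>, \<open>C \<inter> xC\<close>, \<open>xC\<close> vanishes on all three. Hence
  the \<open>x\<close> for which vanishing on \<open>C\<close> and on \<open>xC\<close> are equivalent form an open subgroup \<open>H\<close>, which acts
  on the finite-dimensional space \<open>A|C\<close>. Since \<open>x\<close> acts invertibly and with uniformly bounded
  inverse, \<open>\<integral> |e|\<^sup>2\<close> over \<open>xC\<close> is bounded below on \<open>H\<close> for a unit vector \<open>e\<close>; as \<open>e \<in> L\<^sup>2(G)\<close>, only
  boundedly many translates of \<open>C\<close> by \<open>H\<close> are disjoint, and \<open>H\<close> is compact.\<close>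

subsection \<open>Linear independence modulo null sets\<close>

text \<open>Gaussian elimination, by induction on the equations: an equation \<open>b\<close> with a
  non-zero coefficient at \<open>k\<close> determines the unknown \<open>k\<close> from the others,
  and substituting it leaves one equation and one unknown fewer.\<close>

lemma homogeneous_system_nontrivial:
  fixes C :: "'i \<Rightarrow> 'b \<Rightarrow> 'a::field"
  assumes "finite B" "finite I" "card B < card I"
  shows "\<exists>\<alpha>. (\<exists>i\<in>I. \<alpha> i \<noteq> 0) \<and> (\<forall>b\<in>B. (\<Sum>i\<in>I. \<alpha> i * C i b) = 0)"
  using assms
proof (induction B arbitrary: I C rule: finite_induct)
  case empty
  then obtain i where "i \<in> I" by fastforce
  then show ?case by (intro exI[of _ "\<lambda>_. 1"]) auto
next
  case (insert b B)
  show ?case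
  proof (cases "\<forall>i\<in>I. C i b = 0")
    case True
    then show ?thesis using insert.IH[of I C] insert by auto
  next
    case False
    then obtain k where k: "k \<in> I" "C k b \<noteq> 0" by auto
    define J where "J = I - {k}"
    define C' where "C' i d = C i d - C i b / C k b * C k d" for i d
    have J: "finite J" "I = insert k J" "k \<notin> J" using k insert by (auto simp: J_def)
    then have "card B < card J" using insert by simp
    then obtain \<alpha> where \<alpha>: "\<exists>i\<in>J. \<alpha> i \<noteq> 0" "\<forall>d\<in>B. (\<Sum>i\<in>J. \<alpha> i * C' i d) = 0"
      using insert.IH[OF J(1), of C'] by auto
    define \<beta> where "\<beta> i = (if i = k then - (\<Sum>i\<in>J. \<alpha> i * C i b) / C k b else \<alpha> i)" for i
    have *: "(\<Sum>i\<in>I. \<beta> i * C i d) = (\<Sum>i\<in>J. \<alpha> i * C' i d)" for d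
    proof -
      have "(\<Sum>i\<in>I. \<beta> i * C i d) = \<beta> k * C k d + (\<Sum>i\<in>J. \<alpha> i * C i d)"
        using J by (auto simp: \<beta>_def intro!: sum.cong)
      also have "\<dots> = (\<Sum>i\<in>J. \<alpha> i * C' i d)"
        by (simp add: \<beta>_def C'_def algebra_simps sum_subtractf sum_distrib_left sum_divide_distrib)
      finally show ?thesis .
    qed
    \<comment> \<open>After the elimination, equation \<open>b\<close> has become trivial, so it
      holds as well, although the induction hypothesis only concerns \<open>B\<close>.\<close>
    have "C' i b = 0" for i using k by (simp add: C'_def)
    then have "\<forall>d\<in>insert b B. (\<Sum>i\<in>I. \<beta> i * C i d) = 0" using \<alpha>(2) * by auto
    moreover have "\<exists>i\<in>I. \<beta> i \<noteq> 0" using \<alpha>(1) J by (auto simp: \<beta>_def)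
    ultimately show ?thesis by blast
  qed
qed

definition indep_on :: "'a measure \<Rightarrow> 'a set \<Rightarrow> nat \<Rightarrow> (nat \<Rightarrow> 'a \<Rightarrow> complex) \<Rightarrow> bool" where
  "indep_on M C n s \<longleftrightarrow>
     (\<forall>\<alpha>. (AE y in M. y \<in> C \<longrightarrow> (\<Sum>i<n. \<alpha> i * s i y) = 0) \<longrightarrow> (\<forall>i<n. \<alpha> i = 0))"

lemma indep_on_mono:
  assumes "indep_on M C n s" "C \<subseteq> D" shows "indep_on M D n s"
  unfolding indep_on_def
proof safe
  fix \<alpha> i assume "AE y in M. y \<in> D \<longrightarrow> (\<Sum>i<n. \<alpha> i * s i y) = 0" and i: "i < n"
  then have "AE y in M. y \<in> C \<longrightarrow> (\<Sum>i<n. \<alpha> i * s i y) = 0"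
    using assms(2) by (auto elim!: AE_mp)
  then show "\<alpha> i = 0" using assms(1) i by (auto simp: indep_on_def)
qed

text \<open>Steinitz bound: with more functions than \<open>card B\<close>, the rows of the
  coefficient matrix satisfy a non-trivial relation, which is then a relation between the
  \<open>s i\<close> on \<open>C\<close>. The set \<open>B\<close> merely indexes the spanning
  functions \<open>g b\<close>, so these may be quotients of its elements.\<close>

lemma indep_on_bound:
  assumes "finite B" "indep_on M C n s"
    and span: "\<And>i. i < n \<Longrightarrow> \<exists>c. AE y in M. y \<in> C \<longrightarrow> s i y = (\<Sum>b\<in>B. c b * g b y)"
  shows "n \<le> card B"
proof (rule ccontr)
  assume n: "\<not> n \<le> card B"
  obtain c where c: "\<And>i. i < n \<Longrightarrow> AE y in M. y \<in> C \<longrightarrow> s i y = (\<Sum>b\<in>B. c i b * g b y)"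
    using span by metis
  obtain \<alpha> where \<alpha>: "\<exists>i\<in>{..<n}. \<alpha> i \<noteq> 0" "\<forall>b\<in>B. (\<Sum>i<n. \<alpha> i * c i b) = 0"
    using homogeneous_system_nontrivial[of B "{..<n}" c] assms(1) n by auto
  have "AE y in M. \<forall>i\<in>{..<n}. y \<in> C \<longrightarrow> s i y = (\<Sum>b\<in>B. c i b * g b y)"
    using c by (intro AE_finite_allI) auto
  then have "AE y in M. y \<in> C \<longrightarrow> (\<Sum>i<n. \<alpha> i * s i y) = 0"
  proof (rule AE_mp, intro AE_I2 impI)
    fix y assume *: "\<forall>i\<in>{..<n}. y \<in> C \<longrightarrow> s i y = (\<Sum>b\<in>B. c i b * g b y)" "y \<in> C"
    then have "(\<Sum>i<n. \<alpha> i * s i y) = (\<Sum>i<n. \<Sum>b\<in>B. \<alpha> i * c i b * g b y)"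
      by (auto simp: sum_distrib_left mult.assoc intro!: sum.cong)
    also have "\<dots> = (\<Sum>b\<in>B. (\<Sum>i<n. \<alpha> i * c i b) * g b y)"
      by (subst sum.swap) (simp add: sum_distrib_right)
    finally show "(\<Sum>i<n. \<alpha> i * s i y) = 0" using \<alpha>(2) by simp
  qed
  then show False using assms(2) \<alpha>(1) by (auto simp: indep_on_def)
qed

lemma indep_on_maximal_span:
  assumes s: "indep_on M C n s" and ns: "\<not> indep_on M C (Suc n) (s(n := u))"
  obtains c where "AE y in M. y \<in> C \<longrightarrow> u y = (\<Sum>i<n. c i * s i y)"
proof -
  obtain \<alpha> where \<alpha>: "AE y in M. y \<in> C \<longrightarrow> (\<Sum>i<Suc n. \<alpha> i * (s(n := u)) i y) = 0" "\<exists>i<Suc n. \<alpha> i \<noteq> 0"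
    using ns unfolding indep_on_def by blast
  have 1: "AE y in M. y \<in> C \<longrightarrow> (\<Sum>i<n. \<alpha> i * s i y) + \<alpha> n * u y = 0"
    using \<alpha>(1) by simp
  \<comment> \<open>A relation that does not involve \<open>u\<close> would contradict the
    independence of \<open>s\<close>; hence it can be solved for \<open>u\<close>.\<close>
  have "\<alpha> n \<noteq> 0"
  proof
    assume "\<alpha> n = 0"
    then have "\<forall>i<n. \<alpha> i = 0" using 1 s by (auto simp: indep_on_def)
    then show False using \<alpha>(2) \<open>\<alpha> n = 0\<close> less_Suc_eq by auto
  qed
  have "AE y in M. y \<in> C \<longrightarrow> u y = (\<Sum>i<n. (- \<alpha> i / \<alpha> n) * s i y)"
    using 1
  proof (rule AE_mp, intro AE_I2 impI)
    fix y assume "y \<in> C \<longrightarrow> (\<Sum>i<n. \<alpha> i * s i y) + \<alpha> n * u y = 0" "y \<in> C"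
    then have "u y = - (\<Sum>i<n. \<alpha> i * s i y) / \<alpha> n"
      using \<open>\<alpha> n \<noteq> 0\<close> by (simp add: field_simps eq_neg_iff_add_eq_0)
    then show "u y = (\<Sum>i<n. (- \<alpha> i / \<alpha> n) * s i y)"
      by (simp add: sum_divide_distrib sum_negf)
  qed
  then show ?thesis by (rule that)
qed

text \<open>The dimension of the restriction of \<open>A\<close> to \<open>C\<close>, modulo null
  sets, is encoded by its lower bounds. This avoids quotient spaces and also covers infinite
  dimension; the negation at \<open>Suc n\<close> says that the dimension is at most
  \<open>n\<close>.\<close>

definition rank_ge :: "'a measure \<Rightarrow> ('a \<Rightarrow> complex) set \<Rightarrow> 'a set \<Rightarrow> nat \<Rightarrow> bool" where
  "rank_ge M A C n \<longleftrightarrow> (\<exists>s. (\<forall>i<n. s i \<in> A) \<and> indep_on M C n s)"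

lemma rank_ge_0: "rank_ge M A C 0"
  by (simp add: rank_ge_def indep_on_def)

text \<open>Restriction from \<open>D\<close> to \<open>C\<close> maps the space \<open>A\<close> on
  \<open>D\<close> onto the space \<open>A\<close> on \<open>C\<close>. The first has dimension at
  most \<open>n\<close> and the second at least \<open>n\<close>, so the map is injective.\<close>

lemma rank_rigidity:
  assumes C: "rank_ge M A C n" and D: "\<not> rank_ge M A D (Suc n)" and CD: "C \<subseteq> D"
    and u: "u \<in> A" "AE y in M. y \<in> C \<longrightarrow> u y = 0"
  shows "AE y in M. y \<in> D \<longrightarrow> u y = 0"
proof -
  obtain s where s: "\<forall>i<n. s i \<in> A" "indep_on M C n s" using C by (auto simp: rank_ge_def)
  have "\<forall>i<Suc n. (s(n := u)) i \<in> A" using s u by auto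
  then have "\<not> indep_on M D (Suc n) (s(n := u))" using D unfolding rank_ge_def by blast
  from indep_on_maximal_span[OF indep_on_mono[OF s(2) CD] this]
  obtain c where c: "AE y in M. y \<in> D \<longrightarrow> u y = (\<Sum>i<n. c i * s i y)" by auto
  then have "AE y in M. y \<in> C \<longrightarrow> (\<Sum>i<n. c i * s i y) = 0"
    using u(2) by eventually_elim (use CD in auto)
  then have "\<forall>i<n. c i = 0" using s(2) by (auto simp: indep_on_def)
  with c show ?thesis by simp
qed

subsection \<open>Square-integrable functions\<close>

lemma L2_iff: "u \<in> L2 M \<longleftrightarrow> u \<in> borel_measurable M \<and> integrable M (\<lambda>x. (norm (u x))\<^sup>2)"
  by (simp add: L2_def)

lemma L2_scale: "u \<in> L2 M \<Longrightarrow> (\<lambda>x. c * u x) \<in> L2 M"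
  by (auto simp: L2_iff norm_mult power_mult_distrib)

lemma L2_add:
  assumes "u \<in> L2 M" "v \<in> L2 M" shows "(\<lambda>x. u x + v x) \<in> L2 M"
proof -
  have [measurable]: "u \<in> borel_measurable M" "v \<in> borel_measurable M" using assms by (auto simp: L2_iff)
  have "(norm (a + b))\<^sup>2 \<le> 2 * (norm a)\<^sup>2 + 2 * (norm b)\<^sup>2" for a b :: complex
  proof -
    have "(norm (a + b))\<^sup>2 \<le> (norm a + norm b)\<^sup>2" by (intro power_mono norm_triangle_ineq) auto
    also have "\<dots> \<le> 2 * (norm a)\<^sup>2 + 2 * (norm b)\<^sup>2"
      using zero_le_power2[of "norm a - norm b"] by (simp add: power2_eq_square algebra_simps)
    finally show ?thesis .
  qed
  moreover have "integrable M (\<lambda>x. 2 * (norm (u x))\<^sup>2 + 2 * (norm (v x))\<^sup>2)"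
    using assms by (auto simp: L2_iff)
  ultimately have "integrable M (\<lambda>x. (norm (u x + v x))\<^sup>2)"
    by (auto intro: Bochner_Integration.integrable_bound)
  then show ?thesis by (auto simp: L2_iff)
qed

lemma L2_zero: "(\<lambda>x. 0) \<in> L2 M"
  by (simp add: L2_iff)

section \<open>Inner products and orthonormal systems on a subset\<close>

lemma norm_mult_le_sum_squares:
  fixes a b :: complex shows "norm (a * cnj b) \<le> (norm a)\<^sup>2 + (norm b)\<^sup>2"
proof -
  have "0 \<le> (norm a - norm b)\<^sup>2 + (norm a)\<^sup>2 + (norm b)\<^sup>2" by simp
  then show ?thesis by (simp add: power2_eq_square algebra_simps norm_mult)
qed

text \<open>The inner product of square-integrable functions on \<open>C\<close>, applied to
  functions on the whole space; it is only semi-definite there, its null vectors being the functions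
  that vanish almost everywhere on \<open>C\<close>.\<close>

definition inner_on :: "'a measure \<Rightarrow> 'a set \<Rightarrow> ('a \<Rightarrow> complex) \<Rightarrow> ('a \<Rightarrow> complex) \<Rightarrow> complex" where
  "inner_on M C u v = (LINT y|M. indicator C y * (u y * cnj (v y)))"

lemma integrable_inner_on:
  assumes "u \<in> L2 M" "v \<in> L2 M" "C \<in> sets M"
  shows "integrable M (\<lambda>y. indicator C y * (u y * cnj (v y)))"
proof -
  note [measurable] = assms(3)
  have [measurable]: "u \<in> borel_measurable M" "v \<in> borel_measurable M" using assms by (auto simp: L2_iff)
  have "cnj \<in> borel_measurable borel"
    by (intro borel_measurable_continuous_onI continuous_intros)
  then have [measurable]: "(\<lambda>y. cnj (v y)) \<in> borel_measurable M"
    by (rule measurable_compose[rotated]) simp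
  have "norm (indicator C y * (u y * cnj (v y))) \<le> norm ((norm (u y))\<^sup>2 + (norm (v y))\<^sup>2)" for y
    using norm_mult_le_sum_squares[of "u y" "v y"] by (auto simp: indicator_def)
  then have bound: "AE y in M. norm (indicator C y * (u y * cnj (v y))) \<le> norm ((norm (u y))\<^sup>2 + (norm (v y))\<^sup>2)"
    by (rule AE_I2)
  have "integrable M (\<lambda>y. (norm (u y))\<^sup>2 + (norm (v y))\<^sup>2)"
    using assms by (intro Bochner_Integration.integrable_add) (simp_all add: L2_iff)
  moreover have "(\<lambda>y. indicator C y * (u y * cnj (v y))) \<in> borel_measurable M"
    by measurable
  ultimately show ?thesis using bound by (rule Bochner_Integration.integrable_bound)
qed

text \<open>A crude substitute for Cauchy-Schwarz. The bound does not depend on \<open>C\<close> and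
  sees \<open>u\<close> only through its norm over the whole space, so it is unaffected by
  translating \<open>u\<close>.\<close>

lemma inner_on_bound:
  assumes "u \<in> L2 M" "v \<in> L2 M" "C \<in> sets M"
  shows "norm (inner_on M C u v) \<le> (L2norm M u)\<^sup>2 + (L2norm M v)\<^sup>2"
proof -
  have "norm (inner_on M C u v) \<le> (LINT y|M. norm (indicator C y * (u y * cnj (v y))))"
    unfolding inner_on_def by (rule integral_norm_bound)
  also have "\<dots> \<le> (LINT y|M. (norm (u y))\<^sup>2 + (norm (v y))\<^sup>2)"
  proof (rule integral_mono)
    show "norm (indicator C y * (u y * cnj (v y))) \<le> (norm (u y))\<^sup>2 + (norm (v y))\<^sup>2" for y
      using norm_mult_le_sum_squares[of "u y" "v y"] by (auto simp: indicator_def)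
  qed (use assms integrable_norm[OF integrable_inner_on[OF assms]] in \<open>auto simp: L2_iff\<close>)
  also have "\<dots> = (L2norm M u)\<^sup>2 + (L2norm M v)\<^sup>2"
    using assms by (simp add: L2_iff L2norm_def)
  finally show ?thesis .
qed

lemma inner_on_add_left:
  assumes "u \<in> L2 M" "u' \<in> L2 M" "v \<in> L2 M" "C \<in> sets M"
  shows "inner_on M C (\<lambda>y. u y + u' y) v = inner_on M C u v + inner_on M C u' v"
  unfolding inner_on_def distrib_right distrib_left
  by (intro Bochner_Integration.integral_add integrable_inner_on assms)

lemma inner_on_scale_left: "inner_on M C (\<lambda>y. c * u y) v = c * inner_on M C u v"
proof -
  have "inner_on M C (\<lambda>y. c * u y) v = (LINT y|M. c * (indicator C y * (u y * cnj (v y))))"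
    unfolding inner_on_def by (simp only: ac_simps)
  also have "\<dots> = c * inner_on M C u v"
    unfolding inner_on_def by (rule integral_mult_right_zero)
  finally show ?thesis .
qed

lemma inner_on_cnj: "inner_on M C v u = cnj (inner_on M C u v)"
proof -
  have "cnj (inner_on M C u v) = (LINT y|M. cnj (indicator C y * (u y * cnj (v y))))"
    unfolding inner_on_def by (rule Bochner_Integration.integral_cnj[symmetric])
  also have "\<dots> = inner_on M C v u"
    unfolding inner_on_def by (intro Bochner_Integration.integral_cong) (auto simp: indicator_def)
  finally show ?thesis by simp
qed

lemma inner_on_scale_right: "inner_on M C u (\<lambda>y. c * v y) = cnj c * inner_on M C u v"
proof -
  have "inner_on M C u (\<lambda>y. c * v y) = cnj (c * inner_on M C v u)"
    by (subst inner_on_cnj) (simp only: inner_on_scale_left)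
  then show ?thesis using inner_on_cnj[of M C u v] by simp
qed

lemma L2_sum: "(\<And>i::nat. i < n \<Longrightarrow> e i \<in> L2 M) \<Longrightarrow> (\<lambda>y. \<Sum>i<n. c i * e i y) \<in> L2 M"
proof (induction n)
  case (Suc n)
  then have "(\<lambda>y. (\<Sum>i<n. c i * e i y) + c n * e n y) \<in> L2 M"
    by (intro L2_add L2_scale) simp_all
  then show ?case by simp
qed (simp add: L2_zero)

lemma inner_on_sum_left:
  fixes n :: nat
  assumes "\<And>i. i < n \<Longrightarrow> e i \<in> L2 M" "v \<in> L2 M" "C \<in> sets M"
  shows "inner_on M C (\<lambda>y. \<Sum>i<n. c i * e i y) v = (\<Sum>i<n. c i * inner_on M C (e i) v)"
  using assms(1)
proof (induction n)
  case (Suc n)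
  have "inner_on M C (\<lambda>y. (\<Sum>i<n. c i * e i y) + c n * e n y) v
      = inner_on M C (\<lambda>y. \<Sum>i<n. c i * e i y) v + inner_on M C (\<lambda>y. c n * e n y) v"
    using Suc assms by (intro inner_on_add_left L2_sum L2_scale) auto
  then show ?case using Suc by (simp add: inner_on_scale_left)
qed (simp add: inner_on_def)

lemma inner_on_cong_AE:
  assumes "AE y in M. y \<in> C \<longrightarrow> u y = u' y" "u \<in> L2 M" "u' \<in> L2 M" "v \<in> L2 M" "C \<in> sets M"
  shows "inner_on M C u v = inner_on M C u' v"
  unfolding inner_on_def
proof (rule integral_cong_AE)
  show "AE y in M. indicator C y * (u y * cnj (v y)) = indicator C y * (u' y * cnj (v y))"
    using assms(1) by eventually_elim (auto simp: indicator_def)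
qed (intro borel_measurable_integrable integrable_inner_on assms)+

lemma inner_on_self:
  "inner_on M C u u = complex_of_real (LINT y|M. indicator C y * (norm (u y))\<^sup>2)"
proof -
  have "inner_on M C u u = (LINT y|M. complex_of_real (indicator C y * (norm (u y))\<^sup>2))"
    unfolding inner_on_def
    by (intro Bochner_Integration.integral_cong) (auto simp: indicator_def complex_norm_square simp del: of_real_power)
  also have "\<dots> = complex_of_real (LINT y|M. indicator C y * (norm (u y))\<^sup>2)"
    by (rule integral_complex_of_real)
  finally show ?thesis .
qed

lemma integrable_norm_on:
  assumes "u \<in> L2 M" "C \<in> sets M"
  shows "integrable M (\<lambda>y. indicator C y * (norm (u y))\<^sup>2)"
proof -
  have "integrable M (\<lambda>y. (norm (u y))\<^sup>2 * indicator C y)"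
    using assms by (intro integrable_real_mult_indicator) (simp_all add: L2_iff)
  then show ?thesis by (simp only: mult.commute)
qed

lemma inner_on_self_eq_0:
  assumes "u \<in> L2 M" "C \<in> sets M" "inner_on M C u u = 0"
  shows "AE y in M. y \<in> C \<longrightarrow> u y = 0"
proof -
  have "(LINT y|M. indicator C y * (norm (u y))\<^sup>2) = 0" using assms by (simp add: inner_on_self)
  then have "AE y in M. indicator C y * (norm (u y))\<^sup>2 = 0"
    by (subst (asm) integral_nonneg_eq_0_iff_AE[OF integrable_norm_on[OF assms(1,2)]]) auto
  then show ?thesis by eventually_elim (auto simp: indicator_def)
qed

definition orthonormal_on :: "'a measure \<Rightarrow> 'a set \<Rightarrow> nat \<Rightarrow> (nat \<Rightarrow> 'a \<Rightarrow> complex) \<Rightarrow> bool" where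
  "orthonormal_on M C n e \<longleftrightarrow>
     (\<forall>i<n. \<forall>j<n. inner_on M C (e i) (e j) = (if i = j then 1 else 0))"

lemma inner_on_orthonormal_sum:
  assumes e: "orthonormal_on M C n e" "\<And>i. i < n \<Longrightarrow> e i \<in> L2 M" and C: "C \<in> sets M" and j: "j < n"
  shows "inner_on M C (\<lambda>y. \<Sum>i<n. c i * e i y) (e j) = c j"
proof -
  have "inner_on M C (\<lambda>y. \<Sum>i<n. c i * e i y) (e j) = (\<Sum>i<n. c i * inner_on M C (e i) (e j))"
    by (rule inner_on_sum_left) (use assms in auto)
  also have "\<dots> = (\<Sum>i<n. if i = j then c i else 0)"
    using e j by (intro sum.cong) (auto simp: orthonormal_on_def)
  finally show ?thesis using j by simp
qed

lemma orthonormal_on_indep: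
  assumes e: "orthonormal_on M C n e" "\<And>i. i < n \<Longrightarrow> e i \<in> L2 M" and C: "C \<in> sets M"
  shows "indep_on M C n e"
  unfolding indep_on_def
proof safe
  fix \<alpha> j assume \<alpha>: "AE y in M. y \<in> C \<longrightarrow> (\<Sum>i<n. \<alpha> i * e i y) = 0" and j: "j < n"
  have "\<alpha> j = inner_on M C (\<lambda>y. \<Sum>i<n. \<alpha> i * e i y) (e j)"
    using inner_on_orthonormal_sum[OF e C j] by simp
  also have "\<dots> = inner_on M C (\<lambda>y. 0) (e j)"
    using \<alpha> e j C by (intro inner_on_cong_AE L2_sum L2_zero) auto
  also have "\<dots> = 0" by (simp add: inner_on_def)
  finally show "\<alpha> j = 0" .
qed

text \<open>An orthonormal system of greatest length is a basis on \<open>C\<close>, since a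
  non-zero residual of some \<open>u\<close> could be normalized and appended. The lengths are
  bounded because orthonormal systems are independent.\<close>

lemma orthonormal_basis_exists:
  assumes A: "A \<subseteq> L2 M" and add: "\<And>u v. u \<in> A \<Longrightarrow> v \<in> A \<Longrightarrow> (\<lambda>y. u y + v y) \<in> A"
    and scale: "\<And>u c. u \<in> A \<Longrightarrow> (\<lambda>y. c * u y) \<in> A" and zero: "(\<lambda>y. 0) \<in> A"
    and C: "C \<in> sets M" and bound: "\<And>n. rank_ge M A C n \<Longrightarrow> n \<le> N"
  shows "\<exists>n e. orthonormal_on M C n e \<and> (\<forall>i<n. e i \<in> A) \<and>
    (\<forall>u\<in>A. AE y in M. y \<in> C \<longrightarrow> u y = (\<Sum>i<n. inner_on M C u (e i) * e i y))"
proof -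
  define P where "P n \<longleftrightarrow> (\<exists>e. orthonormal_on M C n e \<and> (\<forall>i<n. e i \<in> A))" for n
  have "P 0" by (simp add: P_def orthonormal_on_def)
  moreover have "n \<le> N" if "P n" for n
  proof -
    from that obtain e where e: "orthonormal_on M C n e" "\<forall>i<n. e i \<in> A" by (auto simp: P_def)
    then have "indep_on M C n e" using A C by (intro orthonormal_on_indep) auto
    then show ?thesis using e by (intro bound) (auto simp: rank_ge_def)
  qed
  ultimately obtain n where n: "P n" "\<And>m. P m \<Longrightarrow> m \<le> n"
    using Nat.ex_has_greatest_nat[of P 0 N] by auto
  from n(1) obtain e where e: "orthonormal_on M C n e" "\<And>i. i < n \<Longrightarrow> e i \<in> A" by (auto simp: P_def)
  have eL: "e i \<in> L2 M" if "i < n" for i using e A that by auto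
  show ?thesis
  proof (intro exI conjI allI impI ballI)
    show "orthonormal_on M C n e" by (rule e(1))
    show "e i \<in> A" if "i < n" for i using that by (rule e(2))
    fix u assume u: "u \<in> A"
    define c where "c i = inner_on M C u (e i)" for i
    \<comment> \<open>The residual of \<open>u\<close> after orthogonal projection, written as a sum
      so that the closure properties of \<open>A\<close> apply.\<close>
    define r where "r y = u y + (\<Sum>i<n. - c i * e i y)" for y
    have sum_A: "(\<lambda>y. \<Sum>i<m. d i * e i y) \<in> A" if "m \<le> n" for m d
      using that by (induction m) (auto intro!: add scale zero e)
    have rA: "r \<in> A" unfolding r_def by (intro add u sum_A) auto
    then have rL: "r \<in> L2 M" using A by auto
    have r_orth: "inner_on M C r (e j) = 0" if "j < n" for j
    proof -
      have "inner_on M C r (e j) = inner_on M C u (e j) + inner_on M C (\<lambda>y. \<Sum>i<n. - c i * e i y) (e j)"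
        unfolding r_def using u A eL that C sum_A[of n "\<lambda>i. - c i"] by (intro inner_on_add_left) auto
      then show ?thesis using inner_on_orthonormal_sum[OF e(1) eL C that, of "\<lambda>i. - c i"] by (simp add: c_def)
    qed
    define R where "R = (LINT y|M. indicator C y * (norm (r y))\<^sup>2)"
    have R: "inner_on M C r r = complex_of_real R" by (simp add: inner_on_self R_def)
    have "R \<ge> 0" unfolding R_def by (intro integral_nonneg_AE) auto
    have "R = 0"
    proof (rule ccontr)
      assume "R \<noteq> 0"
      define w where "w y = complex_of_real (1 / sqrt R) * r y" for y
      have wA: "w \<in> A" unfolding w_def by (intro scale rA)
      have ww: "inner_on M C w w = 1"
        using \<open>R \<ge> 0\<close> \<open>R \<noteq> 0\<close> unfolding w_def inner_on_scale_left inner_on_scale_right R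
        by (simp flip: of_real_mult of_real_divide)
      have we: "inner_on M C w (e j) = 0" if "j < n" for j
        using r_orth[OF that] unfolding w_def inner_on_scale_left by simp
      then have ew: "inner_on M C (e j) w = 0" if "j < n" for j
        using that inner_on_cnj[of M C "e j" w] by simp
      have "orthonormal_on M C (Suc n) (e(n := w))"
        using e(1) ww we ew by (auto simp: orthonormal_on_def less_Suc_eq)
      then have "P (Suc n)" using e wA unfolding P_def by (intro exI[of _ "e(n := w)"]) (auto simp: less_Suc_eq)
      then show False using n(2) by fastforce
    qed
    then have "AE y in M. y \<in> C \<longrightarrow> r y = 0"
      using R rL C by (intro inner_on_self_eq_0) auto
    then show "AE y in M. y \<in> C \<longrightarrow> u y = (\<Sum>i<n. inner_on M C u (e i) * e i y)"
      by eventually_elim (auto simp: r_def c_def sum_negf)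
  qed
qed

subsection \<open>Open subgroups\<close>

text \<open>Each \<open>h\<close> in \<open>H\<close> has the open neighbourhood
  \<open>h + N\<close> inside \<open>H\<close>.\<close>

lemma open_group_subgroup:
  fixes H :: "'g::topological_group_add set"
  assumes H: "group_subgroup H" and N: "open N" "0 \<in> N" "N \<subseteq> H"
  shows "open H"
proof (rule Topological_Spaces.openI)
  fix h assume h: "h \<in> H"
  have "open ((\<lambda>y. - h + y) -` N)"
    by (rule open_vimage[OF N(1)]) (intro continuous_intros)
  moreover have "(\<lambda>y. - h + y) -` N \<subseteq> H"
  proof
    fix y assume "y \<in> (\<lambda>y. - h + y) -` N"
    then have "- h + y \<in> H" using N by auto
    then have "h + (- h + y) \<in> H" using H h unfolding group_subgroup_def by blast
    then show "y \<in> H" by (simp add: add.assoc[symmetric])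
  qed
  ultimately show "\<exists>T. open T \<and> h \<in> T \<and> T \<subseteq> H" using N(2) by force
qed

text \<open>For \<open>x\<close> outside \<open>H\<close>, the coset \<open>x + H\<close> is open
  and disjoint from \<open>H\<close>.\<close>

lemma closed_open_group_subgroup:
  fixes H :: "'g::topological_group_add set"
  assumes H: "group_subgroup H" and "open H"
  shows "closed H"
proof -
  have "open (- H)"
  proof (rule Topological_Spaces.openI)
    fix x assume x: "x \<in> - H"
    have "open ((\<lambda>y. - x + y) -` H)"
      by (rule open_vimage[OF assms(2)]) (intro continuous_intros)
    moreover have "(\<lambda>y. - x + y) -` H \<subseteq> - H"
    proof
      fix y assume y: "y \<in> (\<lambda>y. - x + y) -` H"
      show "y \<in> - H"
      proof
        assume "y \<in> H"
        then have "y + - (- x + y) \<in> H" using H y unfolding group_subgroup_def by blast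
        moreover have "y + - (- x + y) = x" by (simp only: minus_add minus_minus add.assoc[symmetric] right_minus add_0)
        ultimately show False using x by simp
      qed
    qed
    moreover have "x \<in> (\<lambda>y. - x + y) -` H" using H by (simp add: group_subgroup_def)
    ultimately show "\<exists>T. open T \<and> x \<in> T \<and> T \<subseteq> - H" by blast
  qed
  then show ?thesis by (simp add: closed_open)
qed

subsection \<open>Haar measure\<close>

locale haar =
  fixes \<mu> :: "'g::{topological_group_add,t2_space} measure"
  assumes haar_measure: "haar_measure \<mu>"
begin

lemma sets_haar [simp, measurable_cong]: "sets \<mu> = sets borel"
  using haar_measure by (simp add: haar_measure_def)

lemma space_haar [simp]: "space \<mu> = UNIV"
  using sets_eq_imp_space_eq[OF sets_haar] by simp

lemma emeasure_translate: "A \<in> sets borel \<Longrightarrow> emeasure \<mu> ((+) x ` A) = emeasure \<mu> A"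
  using haar_measure by (simp add: haar_measure_def)

lemma emeasure_compact_finite: "compact K \<Longrightarrow> emeasure \<mu> K < \<infinity>"
  using haar_measure by (simp add: haar_measure_def)

lemma compact_sets [measurable]: "compact K \<Longrightarrow> (K :: 'g set) \<in> sets borel"
  by (simp add: borel_closed compact_imp_closed)

lemma outer_regular:
  assumes "A \<in> sets borel" "emeasure \<mu> A < c"
  obtains U where "open U" "A \<subseteq> U" "emeasure \<mu> U < c"
proof -
  have "emeasure \<mu> A = (INF U\<in>{U. open U \<and> A \<subseteq> U}. emeasure \<mu> U)"
    using haar_measure assms unfolding haar_measure_def by blast
  then show ?thesis using assms(2) that by (auto simp: INF_less_iff)
qed

lemma inner_regular_open:
  assumes "open U" "c < emeasure \<mu> U"
  obtains K where "compact K" "K \<subseteq> U" "c < emeasure \<mu> K"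
proof -
  have "emeasure \<mu> U = (SUP K\<in>{K. compact K \<and> K \<subseteq> U}. emeasure \<mu> K)"
    using haar_measure assms unfolding haar_measure_def by blast
  then show ?thesis using assms(2) that by (auto simp: less_SUP_iff)
qed

lemma measurable_translate [measurable]: "(+) x \<in> measurable \<mu> \<mu>"
proof -
  have "(+) x \<in> borel_measurable borel"
    by (intro borel_measurable_continuous_onI continuous_intros)
  then show ?thesis by (simp add: measurable_cong_sets[OF sets_haar sets_haar])
qed

lemma translate_vimage: "(+) x -` A = (+) (- x) ` A" for x :: 'g
proof safe
  fix y assume "x + y \<in> A"
  then show "y \<in> (+) (- x) ` A" by (intro image_eqI[of _ _ "x + y"]) (auto simp: add.assoc[symmetric])
qed (auto simp: add.assoc[symmetric])

lemma mem_translate: "y \<in> (+) x ` C \<longleftrightarrow> - x + y \<in> C" for x :: 'g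
  using translate_vimage[of "- x" C] by auto

lemma translate_sets [measurable]: "C \<in> sets borel \<Longrightarrow> (+) x ` C \<in> sets borel" for x :: 'g
  using measurable_sets[OF measurable_translate[of "- x"], of C] translate_vimage[of "- x" C] by simp

lemma distr_translate: "distr \<mu> \<mu> ((+) x) = \<mu>"
proof (rule measure_eqI)
  fix A assume "A \<in> sets (distr \<mu> \<mu> ((+) x))"
  then show "emeasure (distr \<mu> \<mu> ((+) x)) A = emeasure \<mu> A"
    by (simp add: emeasure_distr translate_vimage emeasure_translate)
qed simp

lemma AE_translate:
  assumes "AE y in \<mu>. P y" shows "AE y in \<mu>. P (x + y)"
  using AE_distrD[OF measurable_translate, where P = P] assms unfolding distr_translate .

lemma AE_translate_on:
  "(AE y in \<mu>. y \<in> C \<longrightarrow> P (x + y)) \<longleftrightarrow> (AE y in \<mu>. y \<in> (+) x ` C \<longrightarrow> P y)"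
proof
  assume "AE y in \<mu>. y \<in> C \<longrightarrow> P (x + y)"
  from AE_translate[OF this, of "- x"] show "AE y in \<mu>. y \<in> (+) x ` C \<longrightarrow> P y"
    by (simp add: mem_translate add.assoc[symmetric])
next
  assume "AE y in \<mu>. y \<in> (+) x ` C \<longrightarrow> P y"
  from AE_translate[OF this, of x] show "AE y in \<mu>. y \<in> C \<longrightarrow> P (x + y)"
    by (simp add: mem_translate add.assoc[symmetric])
qed

lemma integral_translate:
  fixes h :: "'g \<Rightarrow> 'b::{banach, second_countable_topology}"
  assumes "h \<in> borel_measurable \<mu>"
  shows "(LINT y|\<mu>. h (x + y)) = (LINT y|\<mu>. h y)"
  using integral_distr[OF measurable_translate assms, of x] by (simp add: distr_translate)

lemma integrable_translate:
  fixes h :: "'g \<Rightarrow> 'b::{banach, second_countable_topology}"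
  assumes "integrable \<mu> h" shows "integrable \<mu> (\<lambda>y. h (x + y))"
  using integrable_distr[OF measurable_translate[of x], of h] assms by (simp add: distr_translate)

lemma L2_translate:
  assumes "u \<in> L2 \<mu>" shows "(\<lambda>y. u (x + y)) \<in> L2 \<mu>"
  using assms integrable_translate[of "\<lambda>y. (norm (u y))\<^sup>2" x]
    measurable_compose[OF measurable_translate, of u borel x]
  by (auto simp: L2_iff)

lemma L2norm_translate:
  assumes "u \<in> L2 \<mu>" shows "L2norm \<mu> (\<lambda>y. u (x + y)) = L2norm \<mu> u"
  using assms integral_translate[of "\<lambda>y. (norm (u y))\<^sup>2" x] by (auto simp: L2norm_def L2_iff)

text \<open>Inner regularity is given for open sets only. It is transferred to \<open>E\<close> by
  finding a compact \<open>K\<close> that meets \<open>E\<close> in positive measure and removing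
  from \<open>K\<close> an open set \<open>V\<close> around \<open>K - E\<close>.\<close>

lemma compact_subset_of_positive_measure:
  assumes E: "E \<in> sets borel" "0 < emeasure \<mu> E" "emeasure \<mu> E < \<infinity>"
  obtains C where "compact C" "C \<subseteq> E" "0 < emeasure \<mu> C"
proof -
  note [measurable] = E(1)
  obtain U where U: "open U" "E \<subseteq> U" "emeasure \<mu> U < \<infinity>"
    using outer_regular E by metis
  have EU: "emeasure \<mu> E \<le> emeasure \<mu> U" using U by (intro emeasure_mono) auto
  have "emeasure \<mu> U - emeasure \<mu> E < emeasure \<mu> U"
    using U E EU
    by (cases "emeasure \<mu> U"; cases "emeasure \<mu> E") (auto simp: ennreal_minus ennreal_less_iff)
  then obtain K where K: "compact K" "K \<subseteq> U" "emeasure \<mu> U - emeasure \<mu> E < emeasure \<mu> K"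
    using inner_regular_open U by metis
  note [measurable] = compact_sets[OF K(1)]
  \<comment> \<open>Otherwise \<open>K\<close> and \<open>E\<close> would be disjoint up to a null
    set inside \<open>U\<close>, whose measure is too small for both.\<close>
  have KE: "0 < emeasure \<mu> (K \<inter> E)"
  proof (rule ccontr)
    assume "\<not> 0 < emeasure \<mu> (K \<inter> E)"
    then have "emeasure \<mu> (K \<inter> E) = 0" by simp
    then have "emeasure \<mu> K = emeasure \<mu> (K - E)"
      using emeasure_Un_null_set[of "K - E" \<mu> "K \<inter> E"] by (simp add: null_setsI Un_Diff_Int)
    then have "emeasure \<mu> K + emeasure \<mu> E = emeasure \<mu> (K \<union> E)"
      using plus_emeasure[of "K - E" \<mu> E] by auto
    also have "\<dots> \<le> emeasure \<mu> U" using U K by (intro emeasure_mono) auto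
    finally have "emeasure \<mu> K \<le> emeasure \<mu> U - emeasure \<mu> E"
      using E by (simp add: ennreal_le_minus_iff add.commute)
    then show False using K(3) by simp
  qed
  have fin: "emeasure \<mu> (K - E) < \<infinity>"
    using emeasure_mono[of "K - E" K \<mu>] emeasure_compact_finite[OF K(1)] by (simp add: order_le_less_trans)
  have Keq: "emeasure \<mu> K = emeasure \<mu> (K - E) + emeasure \<mu> (K \<inter> E)"
    by (subst plus_emeasure) (auto simp: Un_Diff_Int)
  have "emeasure \<mu> (K - E) < emeasure \<mu> K"
    unfolding Keq using fin KE by (cases "emeasure \<mu> (K - E)"; cases "emeasure \<mu> (K \<inter> E)") (auto simp: ennreal_plus[symmetric] ennreal_less_iff simp del: ennreal_plus)
  then obtain V where V: "open V" "K - E \<subseteq> V" "emeasure \<mu> V < emeasure \<mu> K"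
    using outer_regular[of "K - E"] by auto
  show ?thesis
  proof
    show "compact (K - V)" using K V by (simp add: compact_diff)
    show "K - V \<subseteq> E" using V by auto
    show "0 < emeasure \<mu> (K - V)"
    proof (rule ccontr)
      assume "\<not> 0 < emeasure \<mu> (K - V)"
      then have "emeasure \<mu> (V \<union> (K - V)) = emeasure \<mu> V"
        using V by (intro emeasure_Un_null_set) (auto simp: null_sets_def)
      moreover have "emeasure \<mu> K \<le> emeasure \<mu> (V \<union> (K - V))"
        using V by (intro emeasure_mono) auto
      ultimately show False using V(3) by simp
    qed
  qed
qed

text \<open>Here \<open>E\<close> may have infinite measure. It is exhausted by the level sets
  \<open>F n\<close>, which have finite measure by Markov's inequality, and one of these is not
  null.\<close>

lemma compact_subset_of_nonvanishing:
  fixes h :: "'g \<Rightarrow> real"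
  assumes E: "E \<in> sets borel" and h: "integrable \<mu> h" "\<And>y. y \<in> E \<Longrightarrow> h y > 0" and pos: "E \<notin> null_sets \<mu>"
  obtains C where "compact C" "C \<subseteq> E" "0 < emeasure \<mu> C"
proof -
  note [measurable] = E
  have [measurable]: "h \<in> borel_measurable \<mu>" using h by auto
  define F where "F n = {y\<in>E. h y \<ge> 1 / Suc n}" for n
  have F_eq: "F n = {y\<in>space \<mu>. y \<in> E \<and> h y \<ge> 1 / Suc n}" for n by (auto simp: F_def)
  have Fs [measurable]: "F n \<in> sets borel" for n
    unfolding sets_haar[symmetric] F_eq by measurable
  have "E = (\<Union>n. F n)"
  proof (intro equalityI subsetI)
    fix y assume y: "y \<in> E"
    then obtain n where "1 / real (Suc n) < h y" using h(2) nat_approx_posE by metis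
    then show "y \<in> (\<Union>n. F n)" using y by (auto simp: F_def intro!: exI[of _ n])
  qed (auto simp: F_def)
  then have "\<exists>n. emeasure \<mu> (F n) \<noteq> 0"
    using pos emeasure_UN_eq_0[of \<mu> F] E Fs by (auto simp: null_sets_def image_subset_iff)
  then obtain n where n: "emeasure \<mu> (F n) \<noteq> 0" by auto
  have "emeasure \<mu> (F n) \<le> emeasure \<mu> {y\<in>space \<mu>. norm (h y) \<ge> 1 / Suc n}"
    by (intro emeasure_mono) (auto simp: F_def)
  also have "\<dots> < \<infinity>"
    using integral_Markov_inequality[of \<mu> "\<lambda>y. norm (h y)" "1 / Suc n"] h(1)
    by (simp add: ennreal_less_top order_le_less_trans)
  finally have "emeasure \<mu> (F n) < \<infinity>" .
  from compact_subset_of_positive_measure[OF Fs _ this] n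
  obtain C where "compact C" "C \<subseteq> F n" "0 < emeasure \<mu> C" by (auto simp: zero_less_iff_neq_zero)
  then show ?thesis using that[of C] by (auto simp: F_def)
qed

text \<open>An open \<open>U\<close> around \<open>C\<close> of measure less than twice that of
  \<open>C\<close> contains all translates of \<open>C\<close> by small \<open>x\<close>. Two sets
  of the measure of \<open>C\<close> inside \<open>U\<close> must overlap in positive
  measure.\<close>

lemma compact_meets_small_translates:
  assumes C: "compact C" "0 < emeasure \<mu> C"
  obtains N where "open N" "0 \<in> N" "\<And>x. x \<in> N \<Longrightarrow> 0 < emeasure \<mu> (C \<inter> (+) x ` C)"
proof -
  note [measurable] = compact_sets[OF C(1)]
  have fin: "emeasure \<mu> C < \<infinity>" using C emeasure_compact_finite by blast
  then have "emeasure \<mu> C < emeasure \<mu> C + emeasure \<mu> C"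
    using C by (cases "emeasure \<mu> C") (auto simp: ennreal_plus[symmetric] ennreal_less_iff simp del: ennreal_plus)
  then obtain U where U: "open U" "C \<subseteq> U" "emeasure \<mu> U < emeasure \<mu> C + emeasure \<mu> C"
    using outer_regular by (metis compact_sets[OF C(1)])
  \<comment> \<open>The tube lemma, applied to the preimage of \<open>U\<close> under addition,
    gives one neighbourhood \<open>N\<close> of the identity that works for all points of
    \<open>C\<close>.\<close>
  define W where "W = (\<lambda>p. fst p + snd p) -` U"
  have "open W"
    unfolding W_def by (rule open_vimage[OF U(1)]) (intro continuous_intros)
  moreover have "{0} \<times> C \<subseteq> W" using U(2) by (auto simp: W_def)
  ultimately have "\<exists>N. 0 \<in> N \<and> open N \<and> N \<times> C \<subseteq> W"
    by (rule Elementary_Topology.tube_lemma[OF C(1)])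
  then obtain N where N: "0 \<in> N" "open N" "N \<times> C \<subseteq> W" by auto
  show ?thesis
  proof
    fix x assume x: "x \<in> N"
    show "0 < emeasure \<mu> (C \<inter> (+) x ` C)"
    proof (rule ccontr)
      assume "\<not> 0 < emeasure \<mu> (C \<inter> (+) x ` C)"
      then have 0: "emeasure \<mu> (C \<inter> (+) x ` C) = 0" by simp
      have "emeasure \<mu> C = emeasure \<mu> ((C - (+) x ` C) \<union> (C \<inter> (+) x ` C))" by (simp add: Un_Diff_Int)
      also have "\<dots> = emeasure \<mu> (C - (+) x ` C)"
        using 0 by (intro emeasure_Un_null_set) (auto simp: null_setsI)
      finally have "emeasure \<mu> C + emeasure \<mu> C = emeasure \<mu> (C - (+) x ` C) + emeasure \<mu> ((+) x ` C)"
        by (simp add: emeasure_translate)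
      also have "\<dots> = emeasure \<mu> (C \<union> (+) x ` C)"
        by (subst plus_emeasure) (auto intro!: arg_cong[where f="emeasure \<mu>"])
      also have "\<dots> \<le> emeasure \<mu> U"
        using U N x by (intro emeasure_mono) (auto simp: W_def)
      finally show False using U(3) by simp
    qed
  qed (use N in auto)
qed

end

subsection \<open>Translation invariant subspaces\<close>

locale invariant_subspace = haar \<mu> for \<mu> :: "'g::{topological_group_add,t2_space} measure" +
  fixes A :: "('g \<Rightarrow> complex) set"
  assumes subset_L2: "A \<subseteq> L2 \<mu>"
    and zero: "(\<lambda>y. 0) \<in> A"
    and add: "\<And>u v. u \<in> A \<Longrightarrow> v \<in> A \<Longrightarrow> (\<lambda>y. u y + v y) \<in> A"
    and scale: "\<And>u c. u \<in> A \<Longrightarrow> (\<lambda>y. c * u y) \<in> A"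
    and translate: "\<And>u x. u \<in> A \<Longrightarrow> (\<lambda>y. u (x + y)) \<in> A"
begin

lemma sum_closed: "(\<And>i::nat. i < n \<Longrightarrow> e i \<in> A) \<Longrightarrow> (\<lambda>y. \<Sum>i<n. c i * e i y) \<in> A"
  by (induction n) (auto simp: zero intro!: add scale)

lemma rank_ge_translate:
  assumes "rank_ge \<mu> A ((+) x ` C) n" shows "rank_ge \<mu> A C n"
proof -
  obtain s where s: "\<forall>i<n. s i \<in> A" "indep_on \<mu> ((+) x ` C) n s" using assms by (auto simp: rank_ge_def)
  have "indep_on \<mu> C n (\<lambda>i y. s i (x + y))"
    using s(2) unfolding indep_on_def by (subst AE_translate_on)
  then show ?thesis
    unfolding rank_ge_def using s(1) translate by (intro exI[of _ "\<lambda>i y. s i (x + y)"]) auto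
qed

definition vanishes_on :: "'g set \<Rightarrow> ('g \<Rightarrow> complex) \<Rightarrow> bool" where
  "vanishes_on C u \<longleftrightarrow> (AE y in \<mu>. y \<in> C \<longrightarrow> u y = 0)"

lemma vanishes_on_translate:
  "vanishes_on C (\<lambda>y. u (x + y)) \<longleftrightarrow> vanishes_on ((+) x ` C) u"
  unfolding vanishes_on_def by (rule AE_translate_on)

text \<open>When \<open>A\<close> has finite rank on \<open>C\<close>, an element \<open>x\<close> of this stabilizer acts on the restriction
  of \<open>A\<close> to \<open>C\<close> by \<open>u \<mapsto> u (- x + \<cdot>)\<close>, which is well defined exactly because translation by
  \<open>x\<close> preserves the subspace of functions vanishing on \<open>C\<close>.\<close>

definition vanishing_stabilizer :: "'g set \<Rightarrow> 'g set" where
  "vanishing_stabilizer C = {x. \<forall>u\<in>A. vanishes_on C u \<longleftrightarrow> vanishes_on ((+) x ` C) u}"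

text \<open>Vanishing of \<open>u\<close> on \<open>x + (y + C)\<close> is vanishing of a translate
  of \<open>u\<close> on \<open>y + C\<close>. That translate lies in \<open>A\<close> again, so the
  conditions for \<open>x\<close> and \<open>y\<close> can be applied one after the other.\<close>

lemma vanishing_stabilizer_subgroup: "group_subgroup (vanishing_stabilizer C)"
  unfolding group_subgroup_def
proof (intro conjI ballI)
  show "0 \<in> vanishing_stabilizer C" by (simp add: vanishing_stabilizer_def)
next
  fix x y assume xy: "x \<in> vanishing_stabilizer C" "y \<in> vanishing_stabilizer C"
  have "vanishes_on ((+) (x + y) ` C) u \<longleftrightarrow> vanishes_on C u" if u: "u \<in> A" for u
  proof -
    have "vanishes_on ((+) (x + y) ` C) u \<longleftrightarrow> vanishes_on C (\<lambda>z. u (x + (y + z)))"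
      using vanishes_on_translate[of C u "x + y"] unfolding add.assoc by (rule sym)
    also have "\<dots> \<longleftrightarrow> vanishes_on ((+) y ` C) (\<lambda>z. u (x + z))"
      by (rule vanishes_on_translate)
    also have "\<dots> \<longleftrightarrow> vanishes_on C (\<lambda>z. u (x + z))"
      using xy(2) translate[OF u, of x] by (simp add: vanishing_stabilizer_def)
    also have "\<dots> \<longleftrightarrow> vanishes_on ((+) x ` C) u"
      by (rule vanishes_on_translate)
    also have "\<dots> \<longleftrightarrow> vanishes_on C u"
      using xy(1) u by (simp add: vanishing_stabilizer_def)
    finally show ?thesis .
  qed
  then show "x + y \<in> vanishing_stabilizer C" by (simp add: vanishing_stabilizer_def)
next
  fix x assume x: "x \<in> vanishing_stabilizer C"
  have "vanishes_on ((+) (- x) ` C) u \<longleftrightarrow> vanishes_on C u" if u: "u \<in> A" for u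
  proof -
    have "vanishes_on ((+) (- x) ` C) u \<longleftrightarrow> vanishes_on C (\<lambda>z. u (- x + z))"
      by (rule vanishes_on_translate[symmetric])
    also have "\<dots> \<longleftrightarrow> vanishes_on ((+) x ` C) (\<lambda>z. u (- x + z))"
      using x translate[OF u] by (simp add: vanishing_stabilizer_def)
    also have "\<dots> \<longleftrightarrow> vanishes_on C u"
      using vanishes_on_translate[of C "\<lambda>z. u (- x + z)" x] by (simp add: add.assoc[symmetric])
    finally show ?thesis .
  qed
  then show "- x \<in> vanishing_stabilizer C" by (simp add: vanishing_stabilizer_def)
qed

text \<open>By \<open>rank_rigidity\<close>, restricting to the overlap loses nothing, neither from
  \<open>C\<close> nor from its translate, which has the same rank as \<open>C\<close>.\<close>

lemma vanishing_stabilizer_if_overlap: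
  assumes overlap: "rank_ge \<mu> A (C \<inter> (+) x ` C) n" and C: "\<not> rank_ge \<mu> A C (Suc n)"
  shows "x \<in> vanishing_stabilizer C"
proof -
  have xC: "\<not> rank_ge \<mu> A ((+) x ` C) (Suc n)" using rank_ge_translate C by blast
  have "vanishes_on D u \<longleftrightarrow> vanishes_on (C \<inter> (+) x ` C) u"
    if "u \<in> A" "D = C \<or> D = (+) x ` C" for D u
  proof
    assume "vanishes_on D u"
    then show "vanishes_on (C \<inter> (+) x ` C) u"
      unfolding vanishes_on_def by eventually_elim (use that in auto)
  next
    assume "vanishes_on (C \<inter> (+) x ` C) u"
    then show "vanishes_on D u"
      unfolding vanishes_on_def
      using that rank_rigidity[OF overlap C, of u] rank_rigidity[OF overlap xC, of u] by blast
  qed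
  then show ?thesis by (auto simp: vanishing_stabilizer_def)
qed

text \<open>By Parseval, the mass of \<open>e 0\<close> on \<open>x + C\<close> is the sum of the
  squared coefficients of its translate on \<open>C\<close>; it remains to bound one coefficient
  below, uniformly in \<open>x\<close>.\<close>

lemma mass_bound_on_stabilizer:
  assumes C: "compact C" and e: "orthonormal_on \<mu> C n e" "\<And>i. i < n \<Longrightarrow> e i \<in> A"
    and basis: "\<And>u. u \<in> A \<Longrightarrow> AE y in \<mu>. y \<in> C \<longrightarrow> u y = (\<Sum>i<n. inner_on \<mu> C u (e i) * e i y)"
    and n: "0 < n"
  obtains \<epsilon> where "0 < \<epsilon>"
    "\<And>x. x \<in> vanishing_stabilizer C \<Longrightarrow> \<epsilon> \<le> (LINT y|\<mu>. indicator ((+) x ` C) y * (norm (e 0 y))\<^sup>2)"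
proof -
  have C_sets [measurable]: "C \<in> sets \<mu>" using compact_sets[OF C] by simp
  have eL: "e i \<in> L2 \<mu>" if "i < n" for i using e that subset_L2 by auto
  have [measurable]: "e 0 \<in> borel_measurable \<mu>" using eL[OF n] by (simp add: L2_iff)
  \<comment> \<open>This dominates the inner products on \<open>C\<close> of all translates of the
    \<open>e i\<close> with \<open>e 0\<close>; the summand 1 makes it positive.\<close>
  define K where "K = 1 + (\<Sum>i<n. (L2norm \<mu> (e i))\<^sup>2 + (L2norm \<mu> (e 0))\<^sup>2)"
  have K: "(L2norm \<mu> (e i))\<^sup>2 + (L2norm \<mu> (e 0))\<^sup>2 \<le> K" if "i < n" for i
    using member_le_sum[of i "{..<n}" "\<lambda>i. (L2norm \<mu> (e i))\<^sup>2 + (L2norm \<mu> (e 0))\<^sup>2"] that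
    by (simp add: K_def)
  have "K > 0" unfolding K_def by (intro add_pos_nonneg sum_nonneg) auto
  \<comment> \<open>If all \<open>n\<close> coefficients were smaller than this, their sum weighted
    by \<open>K\<close> would stay below 1.\<close>
  define \<delta> where "\<delta> = 1 / (n * K)"
  have "\<delta> > 0" using n \<open>K > 0\<close> by (simp add: \<delta>_def)
  show ?thesis
  proof
    show "0 < \<delta>\<^sup>2" using \<open>\<delta> > 0\<close> by simp
    fix x assume x: "x \<in> vanishing_stabilizer C"
    then have mx: "- x \<in> vanishing_stabilizer C"
      using vanishing_stabilizer_subgroup by (simp add: group_subgroup_def)
    define v where "v y = e 0 (x + y)" for y
    have vA: "v \<in> A" unfolding v_def using translate e n by auto
    then have vL: "v \<in> L2 \<mu>" using subset_L2 by auto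
    define c where "c i = inner_on \<mu> C v (e i)" for i
    have v_eq: "AE y in \<mu>. y \<in> C \<longrightarrow> v y = (\<Sum>i<n. c i * e i y)"
      unfolding c_def by (rule basis[OF vA])

    txt \<open>The expansion of \<open>v\<close> holds on \<open>C\<close>, hence also on \<open>- x + C\<close>; translating it back expresses
      the unit vector \<open>e 0\<close> through the \<open>c i\<close>, which therefore cannot all be small.\<close>
    define w where "w y = v y + (\<Sum>i<n. - c i * e i y)" for y
    have wA: "w \<in> A" unfolding w_def by (intro add vA sum_closed e)
    have "vanishes_on C w"
      unfolding vanishes_on_def w_def using v_eq by eventually_elim (auto simp: sum_negf)
    then have "vanishes_on C (\<lambda>y. w (- x + y))"
      using mx wA by (simp add: vanishing_stabilizer_def vanishes_on_translate)
    then have e0: "AE y in \<mu>. y \<in> C \<longrightarrow> e 0 y = (\<Sum>i<n. c i * e i (- x + y))"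
      unfolding vanishes_on_def
      by eventually_elim (auto simp: w_def v_def sum_negf add.assoc[symmetric])
    have teL: "(\<lambda>y. e i (- x + y)) \<in> L2 \<mu>" if "i < n" for i
      using L2_translate eL that by blast
    have "1 = inner_on \<mu> C (e 0) (e 0)" using e n by (simp add: orthonormal_on_def)
    also have "\<dots> = inner_on \<mu> C (\<lambda>y. \<Sum>i<n. c i * e i (- x + y)) (e 0)"
      using e0 n by (intro inner_on_cong_AE L2_sum eL teL C_sets) auto
    also have "\<dots> = (\<Sum>i<n. c i * inner_on \<mu> C (\<lambda>y. e i (- x + y)) (e 0))"
      using n by (intro inner_on_sum_left teL eL C_sets) auto
    finally have "1 = norm (\<Sum>i<n. c i * inner_on \<mu> C (\<lambda>y. e i (- x + y)) (e 0))"
      by (metis norm_one)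
    also have "\<dots> \<le> (\<Sum>i<n. norm (c i) * K)"
    proof (rule sum_norm_le)
      fix i assume "i \<in> {..<n}"
      then have i: "i < n" by simp
      have "norm (inner_on \<mu> C (\<lambda>y. e i (- x + y)) (e 0)) \<le> K"
        using inner_on_bound[OF teL[OF i] eL[OF n] C_sets] K[OF i] L2norm_translate[OF eL[OF i]] by simp
      then show "norm (c i * inner_on \<mu> C (\<lambda>y. e i (- x + y)) (e 0)) \<le> norm (c i) * K"
        by (simp add: norm_mult mult_left_mono)
    qed
    finally have sum_c: "1 \<le> (\<Sum>i<n. norm (c i) * K)" .
    have "\<exists>i<n. \<delta> \<le> norm (c i)"
    proof (rule ccontr)
      assume "\<not> (\<exists>i<n. \<delta> \<le> norm (c i))"
      then have "(\<Sum>i<n. norm (c i) * K) < (\<Sum>i<n. \<delta> * K)"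
        using n \<open>K > 0\<close> by (intro sum_strict_mono) auto
      also have "\<dots> = 1" using n \<open>K > 0\<close> by (simp add: \<delta>_def)
      finally show False using sum_c by simp
    qed
    then obtain i where i: "i < n" "\<delta> \<le> norm (c i)" by auto
    have "\<delta>\<^sup>2 \<le> (norm (c i))\<^sup>2" using i \<open>\<delta> > 0\<close> by (intro power_mono) auto
    also have "\<dots> \<le> (\<Sum>i<n. (norm (c i))\<^sup>2)" using i by (intro member_le_sum) auto
    finally have le: "\<delta>\<^sup>2 \<le> (\<Sum>i<n. (norm (c i))\<^sup>2)" .

    have "inner_on \<mu> C v v = inner_on \<mu> C (\<lambda>y. \<Sum>i<n. c i * e i y) v"
      using v_eq by (intro inner_on_cong_AE L2_sum eL vL C_sets) auto
    also have "\<dots> = (\<Sum>i<n. c i * inner_on \<mu> C (e i) v)"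
      by (intro inner_on_sum_left eL vL C_sets)
    also have "\<dots> = (\<Sum>i<n. c i * cnj (c i))"
      unfolding c_def by (intro sum.cong refl arg_cong2[where f="(*)"] inner_on_cnj)
    also have "\<dots> = complex_of_real (\<Sum>i<n. (norm (c i))\<^sup>2)"
      by (simp add: complex_norm_square del: of_real_power)
    finally have "(\<Sum>i<n. (norm (c i))\<^sup>2) = (LINT y|\<mu>. indicator C y * (norm (v y))\<^sup>2)"
      unfolding inner_on_self of_real_eq_iff by simp
    also have "\<dots> = (LINT y|\<mu>. indicator ((+) x ` C) (x + y) * (norm (e 0 (x + y)))\<^sup>2)"
      by (intro Bochner_Integration.integral_cong)
        (auto simp: v_def indicator_def mem_translate add.assoc[symmetric])
    also have "\<dots> = (LINT y|\<mu>. indicator ((+) x ` C) y * (norm (e 0 y))\<^sup>2)"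
      by (rule integral_translate[of "\<lambda>y. indicator ((+) x ` C) y * (norm (e 0 y))\<^sup>2"])
        (use translate_sets[of C x] C_sets in \<open>auto intro!: borel_measurable_times borel_measurable_indicator\<close>)
    finally show "\<delta>\<^sup>2 \<le> (LINT y|\<mu>. indicator ((+) x ` C) y * (norm (e 0 y))\<^sup>2)" using le by simp
  qed
qed

end

text \<open>Pairwise disjoint translates of \<open>C\<close> by elements of \<open>H\<close> each carry mass \<open>\<epsilon>\<close>, so a maximal
  disjoint family \<open>X\<close> is finite, and by maximality \<open>H\<close> lies in the union of the sets \<open>x + C - C\<close>.\<close>

lemma (in haar) compact_if_translates_carry_mass:
  fixes g :: "'g \<Rightarrow> real"
  assumes C: "compact C" "C \<noteq> {}" and g: "integrable \<mu> g" "\<And>y. 0 \<le> g y" and "0 < \<epsilon>"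
    and H: "closed H" "\<And>x. x \<in> H \<Longrightarrow> \<epsilon> \<le> (LINT y|\<mu>. indicator ((+) x ` C) y * g y)"
  shows "compact H"
proof -
  define P where "P X \<longleftrightarrow> finite X \<and> X \<subseteq> H \<and> disjoint_family_on (\<lambda>x. (+) x ` C) X" for X
  define N where "N = (LINT y|\<mu>. g y) / \<epsilon>"
  have int: "integrable \<mu> (\<lambda>y. indicator ((+) x ` C) y * g y)" for x
    using integrable_real_mult_indicator[of "(+) x ` C" \<mu> g] translate_sets[OF compact_sets[OF C(1)]] g(1)
    by (simp add: mult.commute)
  have bound: "card X \<le> nat \<lfloor>N\<rfloor>" if X: "P X" for X
  proof -
    have "card X * \<epsilon> \<le> (\<Sum>x\<in>X. (LINT y|\<mu>. indicator ((+) x ` C) y * g y))"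
      using X H(2) sum_mono[of X "\<lambda>x. \<epsilon>"] by (auto simp: P_def subset_iff)
    also have "\<dots> = (LINT y|\<mu>. (\<Sum>x\<in>X. indicator ((+) x ` C) y * g y))"
      by (rule Bochner_Integration.integral_sum[symmetric]) (rule int)
    also have "\<dots> \<le> (LINT y|\<mu>. g y)"
    proof (rule integral_mono)
      fix y
      have "(\<Sum>x\<in>X. indicator ((+) x ` C) y :: real) = indicator (\<Union>x\<in>X. (+) x ` C) y"
        using X by (intro indicator_UN_disjoint[symmetric]) (auto simp: P_def)
      also have "\<dots> \<le> 1" by (simp add: indicator_def)
      finally show "(\<Sum>x\<in>X. indicator ((+) x ` C) y * g y) \<le> g y"
        using g(2)[of y] by (simp add: sum_distrib_right[symmetric] mult_left_le_one_le sum_nonneg)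
    qed (use int g in auto)
    finally have "card X \<le> N" using \<open>0 < \<epsilon>\<close> by (simp add: N_def field_simps)
    then show ?thesis by linarith
  qed
  have "P {}" by (simp add: P_def disjoint_family_on_def)
  \<comment> \<open>A disjoint family of greatest size; the successor supplies the strict bound on
    the sizes.\<close>
  then obtain X where X: "P X" and max: "\<And>Y. P Y \<Longrightarrow> card Y \<le> card X"
    using Lattices_Big.ex_has_greatest_nat[of P "{}" card "Suc (nat \<lfloor>N\<rfloor>)"] bound by (metis less_Suc_eq_le)
  define D where "D = (\<Union>x\<in>X. (\<lambda>p. x + fst p + - snd p) ` (C \<times> C))"
  have "compact ((\<lambda>p. x + fst p + - snd p) ` (C \<times> C))" for x
    by (intro compact_continuous_image continuous_intros compact_Times C)
  then have "compact D" using X unfolding D_def by (intro compact_UN) (auto simp: P_def)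
  moreover have "H \<subseteq> D"
  proof
    fix h assume h: "h \<in> H"
    have "\<exists>x\<in>X. (+) h ` C \<inter> (+) x ` C \<noteq> {}"
    proof (cases "h \<in> X")
      case True then show ?thesis using C by auto
    next
      case False
      then have "\<not> P (insert h X)" using max[of "insert h X"] X by (auto simp: P_def)
      then show ?thesis using X h False by (auto simp: P_def disjoint_family_on_insert)
    qed
    then obtain x c d where "x \<in> X" "c \<in> C" "d \<in> C" "h + c = x + d" by auto
    moreover from this have "h = x + d + - c" by (metis add.assoc add.right_neutral right_minus)
    ultimately show "h \<in> D" by (force simp: D_def)
  qed
  ultimately show ?thesis using H(1) by (metis inf.absorb_iff2 compact_Int_closed)
qed

section \<open>The compact open subgroup obtained from minimal rank\<close>

context invariant_subspace
begin

lemma compact_open_subgroup: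
  assumes C0: "compact C\<^sub>0" "0 < emeasure \<mu> C\<^sub>0"
    and bound: "\<And>n. rank_ge \<mu> A C\<^sub>0 n \<Longrightarrow> n \<le> N"
    and u: "u \<in> A" "\<And>y. y \<in> C\<^sub>0 \<Longrightarrow> u y \<noteq> 0"
  shows "\<exists>H :: 'g set. group_subgroup H \<and> compact H \<and> open H"
proof -
  define good where "good C \<longleftrightarrow> compact C \<and> C \<subseteq> C\<^sub>0 \<and> 0 < emeasure \<mu> C" for C
  define P where "P n \<longleftrightarrow> (\<exists>C. good C \<and> \<not> rank_ge \<mu> A C (Suc n))" for n
  have rank_bound: "n \<le> N" if "good C" "rank_ge \<mu> A C n" for C n
    using that bound indep_on_mono unfolding good_def rank_ge_def by meson
  have "good C\<^sub>0" using C0 by (simp add: good_def)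
  then have "P N" using rank_bound[of "C\<^sub>0" "Suc N"] by (auto simp: P_def)
  \<comment> \<open>The least dimension of \<open>A\<close> on a compact subset of
    \<open>C\<^sub>0\<close> of positive measure. Some \<open>C\<close> attains it, and by
    \<open>min\<close> no such subset has a smaller one.\<close>
  define n where "n = (LEAST n. P n)"
  have "P n" unfolding n_def using \<open>P N\<close> by (rule LeastI)
  then obtain C where C: "good C" "\<not> rank_ge \<mu> A C (Suc n)" by (auto simp: P_def)
  have min: "rank_ge \<mu> A D n" if "good D" for D
  proof (cases n)
    case 0 then show ?thesis by (simp add: rank_ge_0)
  next
    case (Suc k)
    then have "\<not> P k" using not_less_Least[of k P] by (simp add: n_def[symmetric])
    then show ?thesis using that Suc by (auto simp: P_def)
  qed
  have cC: "compact C" "0 < emeasure \<mu> C" using C by (auto simp: good_def)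
  have C_sets: "C \<in> sets \<mu>" using compact_sets[OF cC(1)] by simp
  define H where "H = vanishing_stabilizer C"
  have Hg: "group_subgroup H" unfolding H_def by (rule vanishing_stabilizer_subgroup)
  obtain U where U: "open U" "0 \<in> U" "\<And>x. x \<in> U \<Longrightarrow> 0 < emeasure \<mu> (C \<inter> (+) x ` C)"
    using compact_meets_small_translates[OF cC] by blast
  have "U \<subseteq> H"
  proof
    fix x assume "x \<in> U"
    moreover have "compact ((+) x ` C)"
      by (intro compact_continuous_image cC continuous_intros)
    \<comment> \<open>The overlap competes in the minimization, so its rank is at least
      \<open>n\<close>, while that of \<open>C\<close> is at most \<open>n\<close>.\<close>
    ultimately have "good (C \<inter> (+) x ` C)"
      using C U(3) by (auto simp: good_def intro: compact_Int)
    then show "x \<in> H" unfolding H_def using vanishing_stabilizer_if_overlap min C(2) by blast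
  qed
  then have Ho: "open H" using open_group_subgroup[OF Hg U(1,2)] by simp
  have "\<exists>m e. orthonormal_on \<mu> C m e \<and> (\<forall>i<m. e i \<in> A) \<and>
      (\<forall>u\<in>A. AE y in \<mu>. y \<in> C \<longrightarrow> u y = (\<Sum>i<m. inner_on \<mu> C u (e i) * e i y))"
    by (rule orthonormal_basis_exists[OF subset_L2 _ _ zero C_sets])
      (erule (1) add, erule scale, erule rank_bound[OF C(1)])
  then obtain m e where "orthonormal_on \<mu> C m e \<and> (\<forall>i<m. e i \<in> A) \<and>
      (\<forall>u\<in>A. AE y in \<mu>. y \<in> C \<longrightarrow> u y = (\<Sum>i<m. inner_on \<mu> C u (e i) * e i y))"
    by (elim exE)
  then have e: "orthonormal_on \<mu> C m e" "\<And>i. i < m \<Longrightarrow> e i \<in> A"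
    "\<And>u. u \<in> A \<Longrightarrow> AE y in \<mu>. y \<in> C \<longrightarrow> u y = (\<Sum>i<m. inner_on \<mu> C u (e i) * e i y)"
    by simp_all
  \<comment> \<open>An empty basis would make \<open>u\<close> vanish almost everywhere on
    \<open>C\<close>, where it has no zeros.\<close>
  have "m \<noteq> 0"
  proof
    assume "m = 0"
    then have "AE y in \<mu>. y \<in> C \<longrightarrow> u y = 0" using e(3)[OF u(1)] by simp
    then have "AE y in \<mu>. y \<notin> C" by eventually_elim (use u(2) C(1) in \<open>auto simp: good_def\<close>)
    then have "emeasure \<mu> C = 0" using compact_sets[OF cC(1)] by (subst (asm) AE_iff_measurable[of C]) auto
    then show False using cC by simp
  qed
  then have "0 < m" by simp
  obtain \<epsilon> where \<epsilon>: "0 < \<epsilon>" "\<And>x. x \<in> H \<Longrightarrow> \<epsilon> \<le> (LINT y|\<mu>. indicator ((+) x ` C) y * (norm (e 0 y))\<^sup>2)"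
    using mass_bound_on_stabilizer[OF cC(1) e \<open>0 < m\<close>] unfolding H_def by blast
  have "compact H"
  proof (rule compact_if_translates_carry_mass[OF cC(1) _ _ _ \<epsilon>(1) closed_open_group_subgroup[OF Hg Ho] \<epsilon>(2)])
    show "C \<noteq> {}" using cC(2) by auto
    show "integrable \<mu> (\<lambda>y. (norm (e 0 y))\<^sup>2)" using e(2)[OF \<open>0 < m\<close>] subset_L2 by (auto simp: L2_iff)
  qed auto
  with Hg Ho show ?thesis by blast
qed

end

section \<open>The range of an operator in the right von Neumann algebra\<close>

context haar
begin

text \<open>Left and right translations commute by associativity, and the modular factor is a
  scalar. Left translations are isometries, whence the bound 1.\<close>

lemma left_translation_in_commutant:
  "(\<lambda>\<xi> y. \<xi> (x + y)) \<in> commutant \<mu> (range (right_reg \<mu>))"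
  unfolding commutant_def bounded_op_def op_eq_def
proof (intro CollectI conjI ballI allI impI)
  show "\<exists>C. \<forall>\<xi>\<in>L2 \<mu>. L2norm \<mu> (\<lambda>y. \<xi> (x + y)) \<le> C * L2norm \<mu> \<xi>"
    by (intro exI[of _ 1]) (simp add: L2norm_translate)
next
  fix \<xi> \<eta> :: "'g \<Rightarrow> complex" assume "AE y in \<mu>. \<xi> y = \<eta> y"
  then show "AE y in \<mu>. \<xi> (x + y) = \<eta> (x + y)" by (rule AE_translate)
qed (auto simp: right_reg_def add.assoc L2_translate)

text \<open>Closing the range of an operator on representatives under almost-everywhere equality makes it
  a genuine linear subspace.\<close>

definition op_range :: "'g op \<Rightarrow> ('g \<Rightarrow> complex) set" where
  "op_range a = {u \<in> L2 \<mu>. \<exists>\<eta>\<in>L2 \<mu>. AE y in \<mu>. u y = a \<eta> y}"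

lemma invariant_subspace_op_range:
  assumes a: "a \<in> right_vN \<mu>"
  shows "invariant_subspace \<mu> (op_range a)"
proof -
  from a have bdd: "bounded_op \<mu> a"
    and comm: "\<And>T. T \<in> commutant \<mu> (range (right_reg \<mu>)) \<Longrightarrow> op_eq \<mu> (a \<circ> T) (T \<circ> a)"
    by (auto simp: right_vN_def commutant_def)
  have lin: "AE y in \<mu>. a (\<lambda>y. c * \<xi> y + \<eta> y) y = c * a \<xi> y + a \<eta> y" if "\<xi> \<in> L2 \<mu>" "\<eta> \<in> L2 \<mu>" for c \<xi> \<eta>
    using bdd that by (simp add: bounded_op_def)
  have lincomb: "(\<lambda>y. c * u y + v y) \<in> op_range a" if uv: "u \<in> op_range a" "v \<in> op_range a" for u v c
  proof -
    obtain \<xi> \<eta> where *: "\<xi> \<in> L2 \<mu>" "\<eta> \<in> L2 \<mu>" "AE y in \<mu>. u y = a \<xi> y" "AE y in \<mu>. v y = a \<eta> y"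
      using uv by (auto simp: op_range_def)
    have "AE y in \<mu>. c * u y + v y = a (\<lambda>y. c * \<xi> y + \<eta> y) y"
      using *(3,4) lin[OF *(1,2), of c] by eventually_elim simp
    moreover have "(\<lambda>y. c * \<xi> y + \<eta> y) \<in> L2 \<mu>" "(\<lambda>y. c * u y + v y) \<in> L2 \<mu>"
      using * uv by (auto simp: op_range_def intro!: L2_add L2_scale)
    ultimately show ?thesis by (auto simp: op_range_def)
  qed
  have "a (\<lambda>y. 0) \<in> op_range a" using bdd L2_zero[of \<mu>] by (auto simp: op_range_def bounded_op_def)
  \<comment> \<open>The operator sends zero to a function that is zero only almost everywhere; the
    exact zero function arises as \<open>- u + u\<close>.\<close>
  from lincomb[OF this this, of "- 1"] have zero: "(\<lambda>y. 0) \<in> op_range a" by simp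
  show ?thesis
  proof (unfold_locales)
    show "op_range a \<subseteq> L2 \<mu>" by (auto simp: op_range_def)
    show "(\<lambda>y. 0) \<in> op_range a" by (rule zero)
    fix u c assume u: "u \<in> op_range a"
    show "(\<lambda>y. c * u y) \<in> op_range a" using lincomb[OF u zero, of c] by simp
    show "(\<lambda>y. u y + v y) \<in> op_range a" if "v \<in> op_range a" for v using lincomb[OF u that, of 1] by simp
    fix x
    obtain \<eta> where \<eta>: "\<eta> \<in> L2 \<mu>" "AE y in \<mu>. u y = a \<eta> y" using u by (auto simp: op_range_def)
    have "AE y in \<mu>. a (\<lambda>y. \<eta> (x + y)) y = a \<eta> (x + y)"
      using comm[OF left_translation_in_commutant[of x]] \<eta>(1) by (simp add: op_eq_def)
    with AE_translate[OF \<eta>(2), of x] have "AE y in \<mu>. u (x + y) = a (\<lambda>y. \<eta> (x + y)) y"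
      by eventually_elim simp
    then show "(\<lambda>y. u (x + y)) \<in> op_range a"
      using L2_translate \<eta>(1) u by (auto simp: op_range_def)
  qed
qed

end

theorem theorem7p2:
  fixes \<mu> :: "'g::{topological_group_add,t2_space} measure"
    and a :: "'g op" and f :: "'g \<Rightarrow> complex"
  assumes "lc_group TYPE('g)"
    and "haar_measure \<mu>"
    and "a \<in> right_vN \<mu>"
    and "f \<in> Linf \<mu>"
    and "finite_rank_op \<mu> (mult_op f \<circ> a)"
    and "nonzero_op \<mu> (mult_op f \<circ> a)"
  shows "\<exists>H :: 'g set. group_subgroup H \<and> compact H \<and> open H"
proof -
  interpret haar \<mu> by unfold_locales fact
  interpret invariant_subspace \<mu> "op_range a" using assms(3) by (rule invariant_subspace_op_range)
  have [measurable]: "f \<in> borel_measurable \<mu>"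
    using assms(4) by (simp add: Linf_def measurable_cong_sets[OF sets_haar refl])
  obtain \<eta> where \<eta>: "\<eta> \<in> L2 \<mu>" "\<not> (AE y in \<mu>. f y * a \<eta> y = 0)"
    using assms(6) by (auto simp: nonzero_op_def mult_op_def)
  have aL: "a \<eta> \<in> L2 \<mu>" using assms(3) \<eta>(1) by (auto simp: right_vN_def commutant_def bounded_op_def)
  then have aA: "a \<eta> \<in> op_range a" using \<eta>(1) by (auto simp: op_range_def)
  have [measurable]: "a \<eta> \<in> borel_measurable \<mu>" using aL by (simp add: L2_iff)
  define E where "E = {y \<in> space \<mu>. f y * a \<eta> y \<noteq> 0}"
  have Es: "E \<in> sets \<mu>" unfolding E_def by measurable
  have "E \<notin> null_sets \<mu>" using \<eta>(2) AE_iff_null[of \<mu> "\<lambda>y. f y * a \<eta> y = 0"] Es by (simp add: E_def)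
  \<comment> \<open>The integrable function \<open>(norm (a \<eta> y))\<^sup>2\<close> is positive
    on \<open>E\<close>, so a compact subset exists even if \<open>E\<close> has infinite
    measure.\<close>
  then obtain C where C: "compact C" "C \<subseteq> E" "0 < emeasure \<mu> C"
    using compact_subset_of_nonvanishing[of E "\<lambda>y. (norm (a \<eta> y))\<^sup>2"] Es aL by (auto simp: L2_iff E_def)
  have nz: "f y \<noteq> 0" "a \<eta> y \<noteq> 0" if "y \<in> C" for y using that C by (auto simp: E_def)
  obtain B where B: "finite B" "\<forall>\<xi>\<in>L2 \<mu>. \<exists>c. AE y in \<mu>. f y * a \<xi> y = (\<Sum>b\<in>B. c b * b y)"
    using assms(5) by (auto simp: finite_rank_op_def mult_op_def)
  \<comment> \<open>Since \<open>f\<close> has no zeros on \<open>C\<close>, dividing by it turns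
    functions spanning the range of \<open>M(f)a\<close> into functions spanning the range of
    \<open>a\<close> on \<open>C\<close>.\<close>
  have span: "\<exists>c. AE y in \<mu>. y \<in> C \<longrightarrow> u y = (\<Sum>b\<in>B. c b * (b y / f y))" if u: "u \<in> op_range a" for u
  proof -
    obtain \<xi> where \<xi>: "\<xi> \<in> L2 \<mu>" "AE y in \<mu>. u y = a \<xi> y" using u by (auto simp: op_range_def)
    obtain c where "AE y in \<mu>. f y * a \<xi> y = (\<Sum>b\<in>B. c b * b y)" using B \<xi> by blast
    with \<xi>(2) have "AE y in \<mu>. y \<in> C \<longrightarrow> u y = (\<Sum>b\<in>B. c b * (b y / f y))"
      by eventually_elim (auto simp: nz field_simps simp flip: sum_divide_distrib)
    then show ?thesis by blast
  qed
  show ?thesis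
  proof (rule compact_open_subgroup[OF C(1,3) _ aA nz(2)])
    fix n assume "rank_ge \<mu> (op_range a) C n"
    then obtain s where s: "\<forall>i<n. s i \<in> op_range a" "indep_on \<mu> C n s" by (auto simp: rank_ge_def)
    show "n \<le> card B"
      by (rule indep_on_bound[OF B(1) s(2), where g = "\<lambda>b y. b y / f y"]) (use span s(1) in blast)
  qed
qed

end
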